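(* For every integer $k \ge 4$, the $k$-ring of squares is uncontainable.
   Context: Graphs are finite, simple and undirected. For an integer $k \ge 3$, the $k$-ring of squares is the cubic graph consisting of $k$ disjoint four-cycles arranged cyclically, with antipodal pairs of points in neighboring four-cycles connected. Explicitly (up to isomorphism): the vertices are $(i,j)$ with $i \in \mathbb{Z}/k$, $j \in \mathbb{Z}/4$; the edges are $(i,j)(i,j+1)$ for all $i,j$ (the four-cycles), together with $(i,0)(i+1,1)$ and $(i,2)(i+1,3)$ for all $i$. Containment: on a connected graph $G$, some number of cops are first placed on edges of $G$ (several cops may share an edge), then the robber chooses a vertex. They then alternate turns, cops first, with full information. On the cops' turn each cop stays put or moves to an adjacent edge (an edge sharing an endpoint with her current edge; moving through a vertex occupied by the robber is allowed). On the robber's turn he stays put or moves to an adjacent vertex along an edge not currently occupied by a cop. The cops win (contain the robber) if at some time it is the robber's turn and every edge incident with the robber's vertex is occupied by at least one cop. A connected graph $G$ is called containable if $\Delta(G)$ cops (where $\Delta(G)$ is the maximum degree) have a strategy guaranteeing a win on $G$, and uncontainable otherwise. *)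

theory Defs
  imports "Graph_Theory.Graph_Theory"
begin

text \<open>
  Finite simple undirected graphs are represented by the locale \<open>pair_graph\<close>
  (finite, loop-free, symmetric arc relation).  An undirected edge is the two-element set
  of the endpoints of an arc; this is what the cops occupy.
\<close>

definition uedges :: "'a pair_pre_digraph \<Rightarrow> 'a set set" where
  "uedges G = {{u, v} | u v. (u, v) \<in> parcs G}"

definition incident_edges :: "'a pair_pre_digraph \<Rightarrow> 'a \<Rightarrow> 'a set set" where
  "incident_edges G v = {e \<in> uedges G. v \<in> e}"

definition max_degree :: "'a pair_pre_digraph \<Rightarrow> nat" where
  "max_degree G = Max ((\<lambda>v. card (incident_edges G v)) ` pverts G)"


text \<open>
  A position of \<open>m\<close> cops is a list of \<open>m\<close> edges, one entry for each cop.
\<close>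

definition cop_position :: "'a pair_pre_digraph \<Rightarrow> nat \<Rightarrow> 'a set list \<Rightarrow> bool" where
  "cop_position G m cs \<longleftrightarrow> length cs = m \<and> set cs \<subseteq> uedges G"

definition cop_move :: "'a set list \<Rightarrow> 'a set list \<Rightarrow> bool" where
  "cop_move cs ds \<longleftrightarrow> list_all2 (\<lambda>e f. f = e \<or> e \<inter> f \<noteq> {}) cs ds"

definition robber_move :: "'a pair_pre_digraph \<Rightarrow> 'a set list \<Rightarrow> 'a \<Rightarrow> 'a \<Rightarrow> bool" where
  "robber_move G cs v w \<longleftrightarrow> w = v \<or> ({v, w} \<in> uedges G \<and> {v, w} \<notin> set cs)"

definition contained :: "'a pair_pre_digraph \<Rightarrow> 'a set list \<Rightarrow> 'a \<Rightarrow> bool" where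
  "contained G cs v \<longleftrightarrow> incident_edges G v \<subseteq> set cs"

text \<open>
  A cop strategy assigns to the list of robber positions seen so far (oldest first) the next
  cop position; its value on the empty list is the initial placement.  The earlier cop
  positions need not be arguments, since the strategy itself determines them.

  Along a robber trajectory \<open>r\<close>, where \<open>r 0\<close> is the vertex he chooses initially,
  \<open>cops_at \<sigma> r n\<close> is the cop position after \<open>n\<close> cop turns.  The robber's turn taken
  at vertex \<open>r n\<close> follows cop turn \<open>n + 1\<close>, so he then faces \<open>cops_at \<sigma> r (Suc n)\<close>.
\<close>

type_synonym 'a cop_strategy = "'a list \<Rightarrow> 'a set list"

definition cops_at :: "'a cop_strategy \<Rightarrow> (nat \<Rightarrow> 'a) \<Rightarrow> nat \<Rightarrow> 'a set list" where
  "cops_at \<sigma> r n = \<sigma> (map r [0..<n])"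

definition robber_run :: "'a pair_pre_digraph \<Rightarrow> 'a cop_strategy \<Rightarrow> (nat \<Rightarrow> 'a) \<Rightarrow> bool" where
  "robber_run G \<sigma> r \<longleftrightarrow>
     r 0 \<in> pverts G \<and> (\<forall>n. robber_move G (cops_at \<sigma> r (Suc n)) (r n) (r (Suc n)))"

text \<open>
  Both players can always stay put, so considering infinite plays only (continued, if need
  be, after the robber has been contained) is no restriction.
\<close>

definition winning_cop_strategy ::
  "'a pair_pre_digraph \<Rightarrow> nat \<Rightarrow> 'a cop_strategy \<Rightarrow> bool" where
  "winning_cop_strategy G m \<sigma> \<longleftrightarrow>
     cop_position G m (\<sigma> []) \<and>
     (\<forall>r. robber_run G \<sigma> r \<longrightarrow>
        (\<forall>n. cop_position G m (cops_at \<sigma> r (Suc n)) \<and>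
             cop_move (cops_at \<sigma> r n) (cops_at \<sigma> r (Suc n))) \<and>
        (\<exists>n. contained G (cops_at \<sigma> r (Suc n)) (r n)))"

text \<open>
  Containability and its negation are only spoken of for connected graphs, so both
  predicates include this requirement.
\<close>

definition connected_graph :: "'a pair_pre_digraph \<Rightarrow> bool" where
  "connected_graph G \<longleftrightarrow> pair_graph G \<and> Digraph_Component.connected (with_proj G)"

definition containable :: "'a pair_pre_digraph \<Rightarrow> bool" where
  "containable G \<longleftrightarrow> connected_graph G \<and> (\<exists>\<sigma>. winning_cop_strategy G (max_degree G) \<sigma>)"

definition uncontainable :: "'a pair_pre_digraph \<Rightarrow> bool" where
  "uncontainable G \<longleftrightarrow> connected_graph G \<and> \<not> containable G"


text \<open>
  The \<open>k\<close>-ring of squares, meant for \<open>k \<ge> 3\<close>.  Vertex \<open>(i, j)\<close> is point \<open>j\<close> of the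
  \<open>i\<close>-th four-cycle, with \<open>i\<close> read modulo \<open>k\<close> and \<open>j\<close> modulo \<open>4\<close>.
\<close>

definition ring_arcs :: "nat \<Rightarrow> (nat \<times> nat) rel" where
  "ring_arcs k =
     {((i, j), (i, (j + 1) mod 4)) | i j. i < k \<and> j < 4} \<union>
     {((i, 0), ((i + 1) mod k, 1)) | i. i < k} \<union>
     {((i, 2), ((i + 1) mod k, 3)) | i. i < k}"

definition ring_of_squares :: "nat \<Rightarrow> (nat \<times> nat) pair_pre_digraph" where
  "ring_of_squares k =
     \<lparr> pverts = {..<k} \<times> {..<4}, parcs = ring_arcs k \<union> (ring_arcs k)\<inverse> \<rparr>"

end

theory Submission
  imports Defs
begin

text \<open>
  Every vertex \<open>v\<close> lies on exactly one edge \<open>link v\<close> that leaves its square.  Let \<open>behind v\<close> consist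
  of the square of \<open>v\<close> and of the neighbouring square into which \<open>link v\<close> does not lead.  The robber
  maintains that no cop touches \<open>link v\<close> or that at most one cop touches \<open>behind v\<close>.  After a turn
  of the cops, if one of the two neighbours of \<open>v\<close> in its square has an untouched link, he moves
  there.  Otherwise the two links are touched by two different cops; their edges lie in
  \<open>behind v\<close>, so before their turn these two cops already touched \<open>behind v\<close> and no cop was at
  \<open>link v\<close>.  Hence \<open>link v\<close> is still unoccupied, and the robber crosses it to a vertex \<open>w\<close>.
  As \<open>k \<ge> 4\<close>, the sets \<open>behind v\<close> and \<open>behind w\<close> are disjoint, so only the third cop
  can touch \<open>behind w\<close>.
\<close>

section \<open>Defeating cop strategies by an invariant of the robber\<close>

definition touches :: "'a set \<Rightarrow> 'a set \<Rightarrow> bool" where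
  "touches e A \<longleftrightarrow> e \<inter> A \<noteq> {}"

text \<open>
  The rules bind \<open>\<sigma>\<close> only along legal robber runs, so the robber's replies are made legal
  unconditionally (he stays put if he has no safe move) before the legality of \<open>\<sigma>\<close> is used.
\<close>

lemma robber_evades:
  assumes start: "\<And>cs. cop_position G m cs \<Longrightarrow> \<exists>v\<in>pverts G. safe cs v"
    and step: "\<And>cs ds v. \<lbrakk>cop_position G m cs; cop_position G m ds; cop_move cs ds; v \<in> pverts G;
      safe cs v\<rbrakk> \<Longrightarrow> \<not> contained G ds v \<and> (\<exists>w\<in>pverts G. robber_move G ds v w \<and> safe ds w)"
  shows "\<not> winning_cop_strategy G m \<sigma>"
proof
  assume win: "winning_cop_strategy G m \<sigma>"
  then have pos0: "cop_position G m (\<sigma> [])"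
    by (simp add: winning_cop_strategy_def)
  with start obtain v0 where v0: "v0 \<in> pverts G" "safe (\<sigma> []) v0"
    by blast
  define good where "good ds v w \<longleftrightarrow> w \<in> pverts G \<and> robber_move G ds v w \<and> safe ds w" for ds v w
  define reply where "reply ds v = (if \<exists>w. good ds v w then SOME w. good ds v w else v)" for ds v
  \<comment> \<open>The recursion runs on the whole history, because that is the argument of
    \<open>\<sigma>\<close>.\<close>
  define hist where "hist = rec_nat [v0] (\<lambda>_ h. h @ [reply (\<sigma> h) (last h)])"
  have hist_0: "hist 0 = [v0]" and
    hist_Suc: "hist (Suc n) = hist n @ [reply (\<sigma> (hist n)) (last (hist n))]" for n
    by (simp_all add: hist_def)
  define r where "r n = last (hist n)" for n
  have hist_r: "hist n = map r [0..<Suc n]" for n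
    by (induction n) (simp_all add: hist_0 hist_Suc r_def)
  have r_0: "r 0 = v0"
    by (simp add: r_def hist_0)
  have r_Suc: "r (Suc n) = reply (cops_at \<sigma> r (Suc n)) (r n)" for n
    unfolding cops_at_def hist_r[symmetric] by (simp add: r_def hist_Suc)
  have good_reply: "good ds v (reply ds v)" if "\<exists>w. good ds v w" for ds v
    using someI_ex[OF that] that by (simp add: reply_def)
  have "robber_move G ds v (reply ds v)" for ds v
    by (cases "\<exists>w. good ds v w")
      (use good_reply in \<open>auto simp: good_def reply_def robber_move_def\<close>)
  then have "robber_run G \<sigma> r"
    using v0 by (simp add: robber_run_def r_0 r_Suc)
  with win have legal: "cop_position G m (cops_at \<sigma> r (Suc n))"
      "cop_move (cops_at \<sigma> r n) (cops_at \<sigma> r (Suc n))"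
    and caught: "\<exists>n. contained G (cops_at \<sigma> r (Suc n)) (r n)" for n
    by (auto simp: winning_cop_strategy_def)
  \<comment> \<open>Legality along the run speaks only of positions after a cop turn; the initial
    placement covers \<open>n = 0\<close>.\<close>
  have pos: "cop_position G m (cops_at \<sigma> r n)" for n
    using pos0 legal(1) by (cases n) (simp_all add: cops_at_def)
  \<comment> \<open>The invariant is read just before cop turn \<open>n + 1\<close>, when the robber
    is already at \<open>r n\<close>.\<close>
  have inv: "r n \<in> pverts G \<and> safe (cops_at \<sigma> r n) (r n)" for n
  proof (induction n)
    case 0
    then show ?case
      using v0 by (simp add: r_0 cops_at_def)
  next
    case (Suc n)
    then have "\<exists>w. good (cops_at \<sigma> r (Suc n)) (r n) w"
      using step[OF pos legal] by (auto simp: good_def)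
    from good_reply[OF this] show ?case
      by (simp add: good_def r_Suc)
  qed
  then show False
    using caught step[OF pos legal] by blast
qed

section \<open>Coordinates on the ring\<close>

definition nxt :: "nat \<Rightarrow> nat \<Rightarrow> nat" where
  "nxt k i = (if Suc i = k then 0 else Suc i)"

definition prv :: "nat \<Rightarrow> nat \<Rightarrow> nat" where
  "prv k i = (if i = 0 then k - 1 else i - 1)"

fun turn :: "nat \<times> nat \<Rightarrow> nat \<times> nat" where
  "turn (i, j) = (i, (j + 1) mod 4)"

abbreviation turn_back :: "nat \<times> nat \<Rightarrow> nat \<times> nat" where
  "turn_back v \<equiv> turn (turn (turn v))"

text \<open>Even points are joined to the next square and odd points to the previous one, so on
  vertices this is an involution.\<close>

fun mate :: "nat \<Rightarrow> nat \<times> nat \<Rightarrow> nat \<times> nat" where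
  "mate k (i, j) = (if even j then (nxt k i, j + 1) else (prv k i, j - 1))"

declare turn.simps [simp del] mate.simps [simp del]

lemmas ring_coords = turn.simps mate.simps nxt_def prv_def

definition link :: "nat \<Rightarrow> nat \<times> nat \<Rightarrow> (nat \<times> nat) set" where
  "link k v = {v, mate k v}"

text \<open>The parity test picks the side that the link avoids: links of even points lead forwards,
  those of odd points backwards.\<close>

definition behind :: "nat \<Rightarrow> nat \<times> nat \<Rightarrow> (nat \<times> nat) set" where
  "behind k v = {fst v, if even (snd v) then prv k (fst v) else nxt k (fst v)} \<times> UNIV"

lemma mod_eq_nxt: "i < k \<Longrightarrow> Suc i mod k = nxt k i"
  by (simp add: nxt_def mod_Suc)

lemma less_4_cases: "(j::nat) < 4 \<longleftrightarrow> j = 0 \<or> j = 1 \<or> j = 2 \<or> j = 3"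
  by auto

lemma nxt_prv:
  assumes "i < k"
  shows "nxt k i < k" "prv k i < k" "nxt k (prv k i) = i" "prv k (nxt k i) = i"
  using assms by (auto simp: nxt_def prv_def)

lemma ring_arcs_iff:
  "(u, v) \<in> ring_arcs k \<longleftrightarrow>
     fst u < k \<and> snd u < 4 \<and> (v = turn u \<or> even (snd u) \<and> v = mate k u)"
  by (cases u; cases v) (auto simp: ring_arcs_def mod_eq_nxt less_4_cases turn.simps mate.simps)

section \<open>The ring as a cubic graph\<close>

context
  fixes k :: nat
  assumes k: "k \<ge> 4"
begin

abbreviation "R \<equiv> ring_of_squares k"

lemma pverts_ring: "v \<in> pverts R \<longleftrightarrow> fst v < k \<and> snd v < 4"
  by (cases v) (auto simp: ring_of_squares_def)

text \<open>Reversing the arcs of \<open>ring_arcs\<close> turns \<open>turn\<close> into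
  \<open>turn_back\<close> and supplies the links of the odd points.\<close>

lemma parcs_ring:
  "(u, v) \<in> parcs R \<longleftrightarrow> u \<in> pverts R \<and> v \<in> {turn u, turn_back u, mate k u}"
proof -
  have "(u, v) \<in> ring_arcs k \<or> (v, u) \<in> ring_arcs k \<longleftrightarrow>
      u \<in> pverts R \<and> v \<in> {turn u, turn_back u, mate k u}"
    using k unfolding ring_arcs_iff pverts_ring
    by (cases u; cases v) (auto simp: less_4_cases nxt_prv turn.simps mate.simps)
  then show ?thesis
    by (simp add: ring_of_squares_def)
qed

lemma ring_verts_closed:
  assumes "v \<in> pverts R"
  shows "turn v \<in> pverts R" "mate k v \<in> pverts R"
  using assms by (cases v; auto simp: pverts_ring nxt_prv less_4_cases turn.simps mate.simps)+

lemma mate_mate: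
  assumes "v \<in> pverts R"
  shows "mate k (mate k v) = v"
  using assms by (cases v) (auto simp: pverts_ring nxt_prv less_4_cases turn.simps mate.simps)

lemma sym_parcs_ring: "sym (parcs R)"
  by (auto simp: ring_of_squares_def sym_def)

lemma edge_at:
  assumes "e \<in> uedges R" "v \<in> e"
  shows "v \<in> pverts R \<and> e \<in> {{v, turn v}, {v, turn_back v}, link k v}"
proof -
  obtain u w where "e = {u, w}" "(u, w) \<in> parcs R" "(w, u) \<in> parcs R"
    using assms sym_parcs_ring by (auto simp: uedges_def dest: symD)
  then show ?thesis
    using assms(2) unfolding parcs_ring link_def by auto
qed

lemma edges_from:
  assumes "v \<in> pverts R"
  shows "{v, turn v} \<in> uedges R" "{v, turn_back v} \<in> uedges R" "link k v \<in> uedges R"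
proof -
  have "{v, w} \<in> uedges R" if "w \<in> {turn v, turn_back v, mate k v}" for w
    using assms that parcs_ring[of v w] unfolding uedges_def by blast
  then show "{v, turn v} \<in> uedges R" "{v, turn_back v} \<in> uedges R" "link k v \<in> uedges R"
    by (simp_all add: link_def)
qed

lemma incident_edges_ring:
  assumes "v \<in> pverts R"
  shows "incident_edges R v = {{v, turn v}, {v, turn_back v}, link k v}"
proof
  show "incident_edges R v \<subseteq> {{v, turn v}, {v, turn_back v}, link k v}"
    using edge_at unfolding incident_edges_def by blast
  show "{{v, turn v}, {v, turn_back v}, link k v} \<subseteq> incident_edges R v"
    using edges_from[OF assms] by (simp add: incident_edges_def link_def)
qed

lemma neighbours_distinct:
  assumes "v \<in> pverts R"
  shows "distinct [v, turn v, turn_back v, mate k v]"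
  using assms k by (cases v) (auto simp: pverts_ring less_4_cases ring_coords)

lemma max_degree_ring: "max_degree R = 3"
proof -
  have "card (incident_edges R v) = 3" if "v \<in> pverts R" for v
    using neighbours_distinct[OF that]
    by (simp add: incident_edges_ring[OF that] link_def doubleton_eq_iff)
  moreover have "(0, 0) \<in> pverts R"
    using k by (simp add: pverts_ring)
  ultimately have "(\<lambda>v. card (incident_edges R v)) ` pverts R = {3}"
    by force
  then show ?thesis
    by (simp add: max_degree_def)
qed

section \<open>Connectedness\<close>

lemma pair_graph_ring: "pair_graph R"
proof
  show "finite (pverts R)" by (simp add: ring_of_squares_def)
  have "parcs R \<subseteq> pverts R \<times> pverts R"
    by (auto simp: parcs_ring ring_verts_closed)
  then show "finite (parcs R)"
    by (rule finite_subset) (simp add: ring_of_squares_def)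
  show "fst e \<in> pverts R" "snd e \<in> pverts R" if "e \<in> parcs R" for e
    using that \<open>parcs R \<subseteq> pverts R \<times> pverts R\<close> by auto
  show "fst e \<noteq> snd e" if "e \<in> parcs R" for e
    using that neighbours_distinct[of "fst e"]
    by (cases e) (auto simp: parcs_ring)
  show "symmetric (with_proj R)"
    using sym_parcs_ring by (simp add: symmetric_def)
qed

lemma connected_ring: "connected_graph R"
proof -
  interpret pair_graph R by (rule pair_graph_ring)
  have turn: "u \<rightarrow>\<^sup>*\<^bsub>with_proj R\<^esub> turn u" and mate: "u \<rightarrow>\<^sup>*\<^bsub>with_proj R\<^esub> mate k u"
    if "u \<in> pverts R" for u
    using that by (simp_all add: parcs_ring reachable_adjI)
  have turns: "u \<rightarrow>\<^sup>*\<^bsub>with_proj R\<^esub> (turn ^^ n) u" if "u \<in> pverts R" for u n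
  proof (induction n)
    case (Suc n)
    then show ?case
      using reachable_trans[OF Suc turn] reachable_in_verts(2)[OF Suc] by simp
  qed (use that in simp)
  have square: "(i, 0) \<rightarrow>\<^sup>*\<^bsub>with_proj R\<^esub> (i, j)" if "i < k" "j < 4" for i j
proof -
    have "(turn ^^ n) (i, 0) = (i, n mod 4)" for n
      by (induction n) (simp_all add: turn.simps mod_Suc_eq)
    with turns[of "(i, 0)" j] that show ?thesis
      by (simp add: pverts_ring)
  qed
  have base: "(0, 0) \<rightarrow>\<^sup>*\<^bsub>with_proj R\<^esub> (i, 0)" if "i < k" for i
    using that
  proof (induction i)
    case 0
    then show ?case by (simp add: pverts_ring)
  next
    \<comment> \<open>The link from point 0 arrives at point 1 of the next square, so the path
      returns to point 0 inside that square.\<close>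
    case (Suc i)
    then have "(i, 0) \<rightarrow>\<^sup>*\<^bsub>with_proj R\<^esub> (Suc i, 1)"
      using mate[of "(i, 0)"] by (simp add: pverts_ring mate.simps nxt_def)
    moreover have "(Suc i, 1) \<rightarrow>\<^sup>*\<^bsub>with_proj R\<^esub> (Suc i, 0)"
      using square[of "Suc i" 1] Suc.prems symmetric_reachable[OF pair_sym_arcs] by simp
    ultimately show ?case
      using Suc.IH Suc.prems reachable_trans by (meson Suc_lessD)
  qed
  have "(0, 0) \<rightarrow>\<^sup>*\<^bsub>with_proj R\<^esub> v" if "v \<in> pverts R" for v
    using reachable_trans[OF base[of "fst v"] square[of "fst v" "snd v"]] that
    by (simp add: pverts_ring)
  then have "u \<rightarrow>\<^sup>*\<^bsub>with_proj R\<^esub> v" if "u \<in> pverts R" "v \<in> pverts R" for u v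
    using that symmetric_reachable[OF pair_sym_arcs] reachable_trans by meson
  then have "strongly_connected (with_proj R)"
    using pverts_ring[of "(0, 0)"] k unfolding strongly_connected_def by fastforce
  \<comment> \<open>\<open>connected\<close> is strong connectedness of the symmetric
    closure.\<close>
  then have "strongly_connected (with_proj (mk_symmetric (with_proj R)))"
    using reachable_mk_symmetricI by (simp add: strongly_connected_def)
  then show ?thesis
    by (simp add: connected_graph_def connected_def pair_graph_ring)
qed

section \<open>Geometry of links and of the squares behind a vertex\<close>

lemma link_eq:
  assumes "v \<in> pverts R" "u \<in> link k v"
  shows "link k u = link k v"
  using assms(2) mate_mate[OF assms(1)] unfolding link_def by force

text \<open>Neighbours within a square have opposite parity, so their links leave it on opposite
  sides.\<close>

lemma link_subset_behind:
  assumes "v \<in> pverts R" "w \<in> {turn v, turn_back v}"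
  shows "link k w \<subseteq> behind k v"
  using assms k
  by (cases v) (auto simp: link_def behind_def pverts_ring less_4_cases turn.simps mate.simps)

text \<open>An edge meeting a link is the link itself or a side of a square at one of its ends, and
  \<open>behind k v\<close> is a union of whole squares.\<close>

lemma edge_touching_link_subset_behind:
  assumes e: "e \<in> uedges R" and v: "v \<in> pverts R" and w: "w \<in> {turn v, turn_back v}"
    and touch: "touches e (link k w)"
  shows "e \<subseteq> behind k v"
proof -
  obtain u where u: "u \<in> e" "u \<in> link k w"
    using touch by (auto simp: touches_def)
  have sub: "link k w \<subseteq> behind k v"
    using link_subset_behind[OF v w] .
  moreover have "w \<in> pverts R"
    using v w ring_verts_closed by blast
  moreover have "turn x \<in> behind k v" if "x \<in> behind k v" for x
    using that by (cases x) (auto simp: behind_def turn.simps)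
  ultimately show ?thesis
    using edge_at[OF e u(1)] link_eq[of w u] u(2) by blast
qed

text \<open>The two neighbours of \<open>v\<close> in its square are antipodal, hence of equal
  parity. Their links join the same two squares, and in each of these their ends are
  antipodal.\<close>

lemma links_far_apart:
  assumes "v \<in> pverts R" "u \<in> link k (turn v)"
  shows "u \<notin> link k (turn_back v)" "turn u \<notin> link k (turn_back v)"
    "turn_back u \<notin> link k (turn_back v)"
proof -
  obtain i j where v: "v = (i, j)" "i < k" "j = 0 \<or> j = 1 \<or> j = 2 \<or> j = 3"
    using assms(1) by (cases v) (auto simp: pverts_ring less_4_cases)
  have ne: "nxt k i \<noteq> i" "prv k i \<noteq> i"
    using k v(2) by (auto simp: nxt_def prv_def)
  from v(3) show "u \<notin> link k (turn_back v)" "turn u \<notin> link k (turn_back v)"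
      "turn_back u \<notin> link k (turn_back v)"
    using assms(2) ne ne[symmetric] unfolding v(1)
    by (elim disjE; force simp: link_def turn.simps mate.simps)+
qed

text \<open>This is why a single cop cannot guard both links next to the robber.\<close>

lemma no_edge_between_links:
  assumes e: "e \<in> uedges R" and v: "v \<in> pverts R"
    and touch: "touches e (link k (turn v))" "touches e (link k (turn_back v))"
  shows False
proof -
  obtain u w where u: "u \<in> e" "u \<in> link k (turn v)" and w: "w \<in> e" "w \<in> link k (turn_back v)"
    using touch by (auto simp: touches_def)
  have "link k u = link k (turn v)"
    using link_eq[OF _ u(2)] ring_verts_closed(1)[OF v] .
  with edge_at[OF e u(1)] w(1) have "w \<in> link k (turn v) \<union> {turn u, turn_back u}"
    using u(2) by blast
  then show False
    using links_far_apart[OF v] u(2) w(2) by blast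
qed

text \<open>If the link joins squares \<open>i\<close> and \<open>i + 1\<close>, the two sets are
  squares \<open>i - 1\<close>, \<open>i\<close> and squares \<open>i + 1\<close>,
  \<open>i + 2\<close>; these four are distinct modulo \<open>k\<close> as
  \<open>k \<ge> 4\<close>.\<close>

lemma behind_disjoint:
  assumes "v \<in> pverts R"
  shows "behind k v \<inter> behind k (mate k v) = {}"
  using assms k
  by (cases v) (auto simp: behind_def pverts_ring less_4_cases ring_coords split: if_splits)

section \<open>The robber's invariant and its preservation\<close>

text \<open>Indices rather than edges are compared, since several cops may share an edge.\<close>

definition safe :: "(nat \<times> nat) set list \<Rightarrow> nat \<times> nat \<Rightarrow> bool" where
  "safe cs v \<longleftrightarrow> (\<forall>e\<in>set cs. \<not> touches e (link k v)) \<or>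
     (\<forall>i<length cs. \<forall>j<length cs. touches (cs ! i) (behind k v) \<and> touches (cs ! j) (behind k v) \<longrightarrow> i = j)"

text \<open>A cop on the edge from \<open>v\<close> to \<open>w\<close> would touch the link of
  \<open>w\<close>, so this edge is free: the robber is not contained and may use it.\<close>

lemma move_to_untouched_link:
  assumes "v \<in> pverts R" "w \<in> {turn v, turn_back v}"
    and "\<forall>e\<in>set ds. \<not> touches e (link k w)"
  shows "\<not> contained R ds v \<and> (\<exists>w\<in>pverts R. robber_move R ds v w \<and> safe ds w)"
proof -
  have "{v, w} \<notin> set ds"
    using assms(3) by (auto simp: touches_def link_def)
  moreover have "{v, w} \<in> incident_edges R v"
    using assms(2) unfolding incident_edges_ring[OF assms(1)] by blast
  moreover have "w \<in> pverts R"
    using assms(1,2) ring_verts_closed by blast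
  moreover have "safe ds w"
    using assms(3) by (simp add: safe_def)
  ultimately show ?thesis
    by (auto simp: contained_def robber_move_def incident_edges_def)
qed

lemma safe_step:
  assumes cs: "cop_position R 3 cs" and ds: "cop_position R 3 ds" and move: "cop_move cs ds"
    and v: "v \<in> pverts R" and safe: "safe cs v"
  shows "\<not> contained R ds v \<and> (\<exists>w\<in>pverts R. robber_move R ds v w \<and> safe ds w)"
proof (cases "\<exists>w\<in>{turn v, turn_back v}. \<forall>e\<in>set ds. \<not> touches e (link k w)")
  case True
  then show ?thesis
    using move_to_untouched_link[OF v] by blast
next
  case False
  have len: "length cs = 3" "length ds = 3"
    using cs ds by (simp_all add: cop_position_def)
  have edge: "ds ! l \<in> uedges R" if "l < 3" for l
    using ds that len by (auto simp: cop_position_def)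
  have moved: "ds ! l = cs ! l \<or> cs ! l \<inter> ds ! l \<noteq> {}" if "l < 3" for l
    using move that len by (auto simp: cop_move_def list_all2_conv_all_nth)
  obtain i j where ij: "i < 3" "touches (ds ! i) (link k (turn v))"
      "j < 3" "touches (ds ! j) (link k (turn_back v))"
    using False len by (auto simp: in_set_conv_nth)
  with no_edge_between_links edge v have "i \<noteq> j"
    by blast
  have sub: "ds ! i \<subseteq> behind k v" "ds ! j \<subseteq> behind k v"
    using edge_touching_link_subset_behind[OF edge v] ij by blast+
  \<comment> \<open>The old edge of a cop equals or meets her new one, which lies wholly in
    \<open>behind k v\<close>. Two cops there refute the second alternative of
    \<open>safe\<close>.\<close>
  have "touches (cs ! i) (behind k v)" "touches (cs ! j) (behind k v)"
    using sub ij moved[of i] moved[of j] by (auto simp: touches_def)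
  with safe \<open>i \<noteq> j\<close> ij len have away: "\<forall>e\<in>set cs. \<not> touches e (link k v)"
    unfolding safe_def by metis
  \<comment> \<open>A cop now on the link would have come from an edge touching it.\<close>
  have free: "link k v \<notin> set ds"
  proof
    assume "link k v \<in> set ds"
    then obtain l where l: "l < 3" "ds ! l = link k v"
      using len by (auto simp: in_set_conv_nth)
    then have "touches (cs ! l) (link k v)"
      using moved[of l] by (auto simp: touches_def link_def)
    with away l(1) len show False
      by simp
  qed
  have only_third: "l \<noteq> i \<and> l \<noteq> j" if "touches (ds ! l) (behind k (mate k v))" for l
    using that sub behind_disjoint[OF v] by (auto simp: touches_def)
  have "safe ds (mate k v)"
    unfolding safe_def
  proof (intro disjI2 allI impI)
    fix l l'
    assume "l < length ds" "l' < length ds"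
      "touches (ds ! l) (behind k (mate k v)) \<and> touches (ds ! l') (behind k (mate k v))"
    with only_third[of l] only_third[of l'] len ij \<open>i \<noteq> j\<close> show "l = l'"
      by linarith
  qed
  moreover have "robber_move R ds v (mate k v)" "\<not> contained R ds v"
    using free edges_from(3)[OF v] incident_edges_ring[OF v]
    by (auto simp: robber_move_def contained_def link_def)
  ultimately show ?thesis
    using ring_verts_closed(2)[OF v] by blast
qed

text \<open>
  Three edges have at most six endpoints, so they touch the links of at most twelve of the
  \<open>4k\<close> vertices.
\<close>

lemma safe_start:
  assumes "cop_position R 3 cs"
  shows "\<exists>v\<in>pverts R. safe cs v"
proof (rule ccontr)
  assume "\<not> ?thesis"
  then have touched: "v \<in> \<Union>(set cs) \<or> mate k v \<in> \<Union>(set cs)" if "v \<in> pverts R" for v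
    using that by (auto simp: safe_def touches_def link_def)
  \<comment> \<open>As \<open>mate k\<close> is an involution, a vertex whose mate is covered is
    itself the mate of a covered vertex.\<close>
  have "v \<in> \<Union>(set cs) \<union> mate k ` \<Union>(set cs)" if "v \<in> pverts R" for v
    using touched[OF that] image_eqI[of v "mate k", OF mate_mate[OF that, symmetric]] by blast
  then have "pverts R \<subseteq> \<Union>(set cs) \<union> mate k ` \<Union>(set cs)"
    by blast
  moreover have edge: "finite e \<and> card e \<le> 2" if e: "e \<in> set cs" for e
  proof -
    obtain u w where "e = {u, w}"
      using e assms unfolding cop_position_def uedges_def by blast
    then show ?thesis
      by (simp add: card_insert_if)
  qed
  moreover have "finite (\<Union>(set cs))"
    using edge by blast
  ultimately have "card (pverts R) \<le> card (\<Union>(set cs)) + card (mate k ` \<Union>(set cs))"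
    by (meson card_Un_le card_mono finite_UnI finite_imageI le_trans)
  also have "\<dots> \<le> 2 * card (\<Union>(set cs))"
    using card_image_le[OF \<open>finite (\<Union>(set cs))\<close>, of "mate k"] by simp
  also have "card (\<Union>(set cs)) \<le> (\<Sum>e\<in>set cs. card e)"
    by (rule card_Union_le_sum_card)
  also have "\<dots> \<le> 2 * card (set cs)"
    using sum_bounded_above[of "set cs" card 2] edge by simp
  also have "card (set cs) \<le> 3"
    using card_length[of cs] assms by (simp add: cop_position_def)
  finally show False
    using k by (simp add: ring_of_squares_def)
qed

end

theorem proposition3p2:
  fixes k :: nat
  assumes "k \<ge> 4"
  shows "uncontainable (ring_of_squares k)"
  using connected_ring[OF assms] max_degree_ring[OF assms]
    robber_evades[where safe = "safe k", OF safe_start[OF assms] safe_step[OF assms]]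
  by (auto simp: uncontainable_def containable_def)

end
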